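(* Let $q\in\mathbb{C}$ with $0<|q|<1$. Let $f$ be holomorphic in $|z|<R$, where $R>1$, let $c,t\in\mathbb{C}$, and suppose that $|t|<R$. Then the identity \[ \sum_{n=0}^{\infty}\frac{(c;q)_n}{(q;q)_n}t^n\Delta_n(f)=\frac{(c,ct;q)_\infty}{(q,t,q/t;q)_\infty}\int_t^1\frac{(sq/t,sq;q)_\infty}{(cs;q)_\infty}f(s)\,d_qs \] holds wherever the displayed expressions are defined, where \[ \Delta_n(f)=\sum_{k=0}^n\frac{(q^{-n};q)_k}{(q;q)_k}f(q^k)q^k . \]
   Context: For $a\in\mathbb{C}$ and $n\in\{0,1,2,\ldots\}\cup\{\infty\}$, $(a;q)_n=\prod_{j=0}^{n-1}(1-aq^j)$ and $(a_1,\ldots,a_r;q)_n=\prod_{i=1}^r(a_i;q)_n$. The Jackson $q$-integral (without the conventional factor $1-q$) is \[ \int_u^v g(s)\,d_qs:=\sum_{n=0}^{\infty}\bigl(vq^n g(vq^n)-uq^n g(uq^n)\bigr), \] whenever the series converges. Double sums are understood as iterated sums, with the terminating inner sum evaluated first. Parameters are assumed to be such that no denominator vanishes. *)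

theory Defs
  imports "HOL-Complex_Analysis.Complex_Analysis"
begin

definition qpoch :: "complex \<Rightarrow> complex \<Rightarrow> nat \<Rightarrow> complex" where
  "qpoch a q n = (\<Prod>j<n. 1 - a * q ^ j)"

definition qpoch_inf :: "complex \<Rightarrow> complex \<Rightarrow> complex" where
  "qpoch_inf a q = (\<Prod>j. 1 - a * q ^ j)"

text \<open>The Jackson \<open>q\<close>-integral of \<open>g\<close> from \<open>u\<close> to \<open>v\<close>, normalised without the
  conventional factor \<open>1 - q\<close>.\<close>

definition jackson_integrable ::
    "complex \<Rightarrow> complex \<Rightarrow> complex \<Rightarrow> (complex \<Rightarrow> complex) \<Rightarrow> bool" where
  "jackson_integrable q u v g \<longleftrightarrow>
     summable (\<lambda>n. v * q ^ n * g (v * q ^ n) - u * q ^ n * g (u * q ^ n))"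

definition jackson_integral ::
    "complex \<Rightarrow> complex \<Rightarrow> complex \<Rightarrow> (complex \<Rightarrow> complex) \<Rightarrow> complex" where
  "jackson_integral q u v g =
     (\<Sum>n. v * q ^ n * g (v * q ^ n) - u * q ^ n * g (u * q ^ n))"

definition Delta :: "complex \<Rightarrow> nat \<Rightarrow> (complex \<Rightarrow> complex) \<Rightarrow> complex" where
  "Delta q n f =
     (\<Sum>k\<le>n. qpoch (q powi (- int n)) q k / qpoch q q k * f (q ^ k) * q ^ k)"

end

theory Submission
  imports Defs
begin

text \<open>
  Both sides of the identity are linear in \<open>f\<close> and respect the expansion of \<open>f\<close> into its Taylor
  series at the origin, so the theorem reduces to \<open>f(s) = s^m\<close>.

  On the left, the terminating \<open>q\<close>-binomial theorem gives
  \<open>\<Delta>_n(s^m) = (q;q)_m / (q;q)_{m-n}\<close> for \<open>n \<le> m\<close> and \<open>0\<close> for \<open>n > m\<close>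
  (\<open>Delta_monomial\<close>).  The left-hand side for \<open>s^m\<close> is therefore the finite sum
  \<open>h_m = \<Sum>_n [m,n]_q (c;q)_n t^n\<close>, an Al-Salam--Carlitz polynomial in \<open>t\<close>.

  On the right, the Jackson integral of \<open>s^m\<close> against the weight
  \<open>w(s) = (sq/t, sq;q)_\<infinity> / (cs;q)_\<infinity>\<close> is the \<open>m\<close>-th moment \<open>M_m\<close> of \<open>w\<close>.
  The weight satisfies a first-order \<open>q\<close>-difference equation with polynomial coefficients, because
  \<open>w(s/q) (1 - cs/q) = (1 - s/t) (1 - s) w(s)\<close>; multiplying by \<open>s^m\<close> and summing by
  telescoping yields
  \<open>M_{m+1} = (1 + t - c t q^m) M_m - t (1 - q^m) M_{m-1}\<close>.
  The \<open>h_m\<close> obey the same recurrence with \<open>h_0 = 1\<close>, so \<open>M_m = M_0 h_m\<close>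
  (\<open>moment_eq_al_salam_carlitz\<close>).

  It remains to find the total mass \<open>M_0\<close>, as a function of \<open>c\<close>.  Since
  \<open>w\<close> for the parameter \<open>cq\<close> is \<open>(1 - cs) w(s)\<close>, the formula for \<open>M_1\<close> gives
  \<open>M_0(cq) = (1 - c)(1 - ct) M_0(c)\<close>.  Hence \<open>M_0(c) (c, ct;q)_\<infinity>\<close> does not change under
  \<open>c \<mapsto> cq\<close>, and passing to the limit along \<open>c q^N \<rightarrow> 0\<close> shows that its value is the same for all
  \<open>c\<close> (\<open>moment_0_invariant\<close>).  At \<open>c = q\<close> the weight loses a factor and the defining series
  telescopes, so that value can be read off (\<open>moment_0_eval\<close>) and is
  \<open>(q, t, q/t;q)_\<infinity>\<close>.  This is exactly the normalisation in the theorem.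
\<close>

section \<open>Interchanging two series\<close>

text \<open>Fubini's theorem for iterated series: summable bounds on the absolute row sums make the whole
  array absolutely summable, and its sum may then be taken by rows or by columns.\<close>

lemma sums_swap:
  fixes f :: "nat \<Rightarrow> nat \<Rightarrow> 'a :: banach"
  assumes summ: "\<And>m. summable (\<lambda>n. norm (f m n))"
    and bound: "\<And>m. (\<Sum>n. norm (f m n)) \<le> B m" and "summable B"
  shows "(\<lambda>n. \<Sum>m. f m n) sums (\<Sum>m. \<Sum>n. f m n)"
    "summable (\<lambda>m. \<Sum>n. f m n)"
proof -
  have norm_row: "((\<lambda>n. norm (f m n)) has_sum (\<Sum>n. norm (f m n))) UNIV" for m
    by (rule norm_summable_imp_has_sum) (use summ in auto)
  have row: "(f m has_sum (\<Sum>n. f m n)) UNIV" for m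
    by (rule norm_summable_imp_has_sum[OF summ summable_sums[OF summable_norm_cancel[OF summ]]])
  have nn: "0 \<le> (\<Sum>n. norm (f m n))" for m
    by (intro suminf_nonneg summ) auto
  have sB: "summable (\<lambda>m. norm (\<Sum>n. norm (f m n)))"
    by (rule summable_comparison_test[OF _ \<open>summable B\<close>]) (use bound nn in auto)
  have abs: "(\<lambda>x. norm (case x of (m, n) \<Rightarrow> f m n)) summable_on UNIV \<times> UNIV"
    unfolding Infinite_Sum.abs_summable_on_Sigma_iff
  proof (intro conjI ballI)
    fix m
    show "(\<lambda>n. norm (case (m, n) of (m, n) \<Rightarrow> f m n)) summable_on UNIV"
      using norm_row[of m] by (auto simp: summable_on_def)
    show "(\<lambda>m. norm (\<Sum>\<^sub>\<infinity>n. norm (case (m, n) of (m, n) \<Rightarrow> f m n))) summable_on UNIV"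
      using norm_summable_imp_summable_on[of "\<lambda>m. norm (\<Sum>n. norm (f m n))"] sB
      by (simp add: infsumI[OF norm_row])
  qed
  have S: "(\<lambda>(m, n). f m n) summable_on UNIV \<times> UNIV"
    by (rule abs_summable_summable[OF abs])
  then obtain T where T: "((\<lambda>(m, n). f m n) has_sum T) (UNIV \<times> UNIV)"
    by (auto simp: summable_on_def)
  have "((\<lambda>m. \<Sum>n. f m n) has_sum T) UNIV"
    by (rule has_sum_SigmaD[OF T]) (use row in simp)
  from has_sum_imp_sums[OF this] have total: "T = (\<Sum>m. \<Sum>n. f m n)"
    and "summable (\<lambda>m. \<Sum>n. f m n)"
    by (simp_all add: sums_iff)
  then show "summable (\<lambda>m. \<Sum>n. f m n)" by simp
  have T': "((\<lambda>(n, m). f m n) has_sum T) (UNIV \<times> UNIV)"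
    using T by (subst has_sum_swap) simp
  have entry: "norm (f m n) \<le> B m" for m n
    using sum_le_suminf[OF summ[of m], of "{n}"] bound[of m] by simp
  have col_norm: "summable (\<lambda>m. norm (f m n))" for n
    by (intro summable_comparison_test[OF _ \<open>summable B\<close>]) (use entry in auto)
  have col: "((\<lambda>m. f m n) has_sum (\<Sum>m. f m n)) UNIV" for n
    by (rule norm_summable_imp_has_sum[OF col_norm summable_sums[OF summable_norm_cancel[OF col_norm]]])
  have "((\<lambda>n. \<Sum>m. f m n) has_sum T) UNIV"
    by (rule has_sum_SigmaD[OF T']) (use col in simp)
  then show "(\<lambda>n. \<Sum>m. f m n) sums (\<Sum>m. \<Sum>n. f m n)"
    by (simp add: has_sum_imp_sums total)
qed

section \<open>The polynomials, the weight and its moments\<close>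

text \<open>The value \<open>0\<close> above the diagonal is what makes the Pascal-type rules hold at the boundary
  of their range.\<close>

definition qbinomial :: "complex \<Rightarrow> nat \<Rightarrow> nat \<Rightarrow> complex" where
  "qbinomial q m n = (if n \<le> m then qpoch q q m / (qpoch q q n * qpoch q q (m - n)) else 0)"

text \<open>The Al-Salam--Carlitz polynomials, usually written \<open>\<phi>_m^{(c)}(t|q)\<close>; for
  \<open>c = 0\<close> they are the Rogers--Szego polynomials.\<close>

definition al_salam_carlitz :: "complex \<Rightarrow> complex \<Rightarrow> complex \<Rightarrow> nat \<Rightarrow> complex" where
  "al_salam_carlitz q c t m = (\<Sum>n\<le>m. qbinomial q m n * qpoch c q n * t ^ n)"

definition weight :: "complex \<Rightarrow> complex \<Rightarrow> complex \<Rightarrow> complex \<Rightarrow> complex" where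
  "weight q c t s = qpoch_inf (s * q / t) q * qpoch_inf (s * q) q / qpoch_inf (c * s) q"

text \<open>This is \<open>s^m (1 - cs/q) w(s/q)\<close> for the weight \<open>w\<close>.  Its \<open>q\<close>-difference is \<open>s w(s)\<close> times
  a combination of at most three consecutive powers of \<open>s\<close>, and it vanishes at both end points
  \<open>1\<close> and \<open>t\<close> of the integral.\<close>

definition q_primitive :: "complex \<Rightarrow> complex \<Rightarrow> complex \<Rightarrow> nat \<Rightarrow> complex \<Rightarrow> complex" where
  "q_primitive q c t m s = s ^ m * (qpoch_inf (s / t) q * qpoch_inf s q / qpoch_inf (c * s) q)"

text \<open>The factors \<open>1\<close> stand for the upper limit of integration; keeping them lets statements about a
  progression \<open>v q^n\<close> be instantiated uniformly with \<open>v = 1\<close> and \<open>v = t\<close>.\<close>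

definition jackson_term :: "complex \<Rightarrow> complex \<Rightarrow> (complex \<Rightarrow> complex) \<Rightarrow> nat \<Rightarrow> complex" where
  "jackson_term q t g n = 1 * q ^ n * g (1 * q ^ n) - t * q ^ n * g (t * q ^ n)"

definition moment :: "complex \<Rightarrow> complex \<Rightarrow> complex \<Rightarrow> nat \<Rightarrow> complex" where
  "moment q c t m = (\<Sum>n. jackson_term q t (\<lambda>s. weight q c t s * s ^ m) n)"

section \<open>Infinite q-shifted factorials\<close>

context
  fixes q :: complex
  assumes q_nz: "q \<noteq> 0" and q_lt: "norm q < 1"
begin

lemma power_q_tendsto_0: "(\<lambda>n. a * q ^ n) \<longlonglongrightarrow> 0"
  by (intro tendsto_mult_right_zero LIMSEQ_power_zero q_lt)

lemma convergent_prod_qpoch: "convergent_prod (\<lambda>j. 1 - a * q ^ j)"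
proof (intro abs_convergent_prod_imp_convergent_prod summable_imp_abs_convergent_prod)
  have "summable (\<lambda>j. norm a * norm q ^ j)"
    using q_lt by (intro summable_mult summable_geometric) auto
  then show "summable (\<lambda>j. norm (1 - a * q ^ j - 1))"
    by (simp add: norm_mult norm_power)
qed

lemma qpoch_tendsto: "(\<lambda>n. qpoch a q n) \<longlonglongrightarrow> qpoch_inf a q"
  unfolding qpoch_def qpoch_inf_def
  by (intro has_prod_imp_tendsto' convergent_prod_has_prod convergent_prod_qpoch)

lemma qpoch_0 [simp]: "qpoch a q 0 = 1"
  by (simp add: qpoch_def)

lemma qpoch_Suc: "qpoch a q (Suc n) = qpoch a q n * (1 - a * q ^ n)"
  by (simp add: qpoch_def)

lemma qpoch_Suc_shift: "qpoch a q (Suc n) = (1 - a) * qpoch (a * q) q n"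
  unfolding qpoch_def by (subst prod.lessThan_Suc_shift) (simp add: mult_ac)

lemma qpoch_inf_split: "qpoch_inf a q = qpoch a q n * qpoch_inf (a * q ^ n) q"
proof -
  have "(\<lambda>j. 1 - a * q ^ j) has_prod ((\<Prod>k<n. 1 - a * q ^ k) * (\<Prod>k. 1 - a * q ^ (k + n)))"
    by (rule has_prod_ignore_initial_segment'[OF convergent_prod_qpoch])
  then show ?thesis
    unfolding qpoch_def qpoch_inf_def has_prod_iff by (simp add: power_add mult_ac)
qed

lemma qpoch_inf_step: "qpoch_inf a q = (1 - a) * qpoch_inf (a * q) q"
  using qpoch_inf_split[of a 1] by (simp add: qpoch_Suc)

lemma qpoch_inf_0 [simp]: "qpoch_inf 0 q = 1"
  by (simp add: qpoch_inf_def)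

lemma qpoch_inf_1 [simp]: "qpoch_inf 1 q = 0"
  using qpoch_inf_step[of 1] by simp

lemma qpoch_inf_nonzero:
  assumes "norm a < 1" shows "qpoch_inf a q \<noteq> 0"
  unfolding qpoch_inf_def
proof (rule prodinf_nonzero[OF convergent_prod_qpoch])
  fix i
  have "norm a * norm q ^ i \<le> norm a * 1"
    using q_lt by (intro mult_left_mono power_le_one) auto
  with assms have "norm (a * q ^ i) < 1"
    by (simp add: norm_mult norm_power)
  then show "1 - a * q ^ i \<noteq> 0" by auto
qed

lemma qpoch_q_inf_nonzero [simp]: "qpoch_inf q q \<noteq> 0"
  by (rule qpoch_inf_nonzero[OF q_lt])

lemma qpoch_q_nonzero [simp]: "qpoch q q n \<noteq> 0"
  using qpoch_inf_split[of q n] by auto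

lemma qpoch_inf_geometric_nonzero: "qpoch_inf a q \<noteq> 0 \<Longrightarrow> qpoch_inf (a * q ^ n) q \<noteq> 0"
  using qpoch_inf_split[of a n] by auto

lemma one_minus_q_power_nonzero [simp]: "1 - q ^ Suc n \<noteq> 0" "1 - q * q ^ n \<noteq> 0"
  using qpoch_q_nonzero[of "Suc n"] by (auto simp: qpoch_Suc)

text \<open>Along every geometric progression with ratio \<^term>\<open>q\<close> the infinite product tends
  to its value at the origin: beyond the indices where a zero may sit, each value is a
  fixed nonzero product divided by one of its partial products.  A Jackson integral samples its integrand along such
  progressions only, so this limit takes the place of continuity in all the estimates below.\<close>

lemma qpoch_inf_geometric_tendsto_1: "(\<lambda>n. qpoch_inf (a * q ^ n) q) \<longlonglongrightarrow> 1"
proof -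
  have "\<forall>\<^sub>F n in sequentially. norm (a * q ^ n) < 1"
    using order_tendstoD(2)[OF tendsto_norm[OF power_q_tendsto_0[of a]], of 1] by simp
  then obtain N where N: "norm (a * q ^ N) < 1"
    by (auto simp: eventually_sequentially)
  let ?b = "a * q ^ N"
  have nz: "qpoch_inf ?b q \<noteq> 0" by (rule qpoch_inf_nonzero[OF N])
  have "(\<lambda>n. qpoch_inf ?b q / qpoch ?b q n) \<longlonglongrightarrow> qpoch_inf ?b q / qpoch_inf ?b q"
    by (intro tendsto_intros qpoch_tendsto nz)
  moreover have "qpoch_inf ?b q / qpoch ?b q n = qpoch_inf (a * q ^ (n + N)) q" for n
    using qpoch_inf_split[of ?b n] nz by (auto simp: power_add mult_ac)
  ultimately have "(\<lambda>n. qpoch_inf (a * q ^ (n + N)) q) \<longlonglongrightarrow> 1"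
    using nz by simp
  then show ?thesis by (rule LIMSEQ_offset)
qed

section \<open>The Al-Salam--Carlitz polynomials\<close>

lemmas q_nonzeros = qpoch_q_nonzero one_minus_q_power_nonzero

lemma qbinomial_0 [simp]: "qbinomial q m 0 = 1"
  by (simp add: qbinomial_def)

lemma qbinomial_pascal:
  assumes "n \<le> m"
  shows "qbinomial q (Suc m) (Suc n) = qbinomial q m (Suc n) + q ^ (m - n) * qbinomial q m n"
proof (cases "n = m")
  case True
  then show ?thesis by (simp add: qbinomial_def)
next
  case False
  with assms obtain d where m: "m = n + Suc d"
    by (metis less_imp_Suc_add le_neq_implies_less add_Suc_right)
  (* With d = m - n - 1, the rule is this splitting of 1 - q^(m+1) put over a common denominator. *)
  have split: "1 - q * q ^ m = (1 - q * q ^ d) + q ^ Suc d * (1 - q * q ^ n)"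
    by (simp add: m algebra_simps power_add)
  have fractions: "Z * (V + p * U) / ((X * U) * (Y * V)) = Z / ((X * U) * Y) + p * (Z / (X * (Y * V)))"
    if "U \<noteq> 0" "V \<noteq> 0" "X \<noteq> 0" "Y \<noteq> 0" for U V X Y Z p :: complex
    using that by (simp add: field_simps)
  have "qbinomial q (Suc m) (Suc n) =
      qpoch q q m * (1 - q * q ^ m) / ((qpoch q q n * (1 - q * q ^ n)) * (qpoch q q d * (1 - q * q ^ d)))"
    by (simp add: qbinomial_def m qpoch_Suc)
  also have "\<dots> = qpoch q q m / ((qpoch q q n * (1 - q * q ^ n)) * qpoch q q d)
      + q ^ Suc d * (qpoch q q m / (qpoch q q n * (qpoch q q d * (1 - q * q ^ d))))"
    unfolding split by (intro fractions) (rule q_nonzeros)+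
  also have "\<dots> = qbinomial q m (Suc n) + q ^ (m - n) * qbinomial q m n"
    by (simp add: qbinomial_def m qpoch_Suc)
  finally show ?thesis .
qed

text \<open>The lower index stays fixed here, which is what trades the coefficient \<open>1 - q^{m+1}\<close> of the
  recurrence below for a factor depending on \<open>n\<close>.\<close>

lemma qbinomial_absorb:
  assumes "n \<le> Suc m"
  shows "(1 - q ^ Suc m) * qbinomial q m n = (1 - q ^ (Suc m - n)) * qbinomial q (Suc m) n"
proof (cases "n = Suc m")
  case True
  then show ?thesis by (simp add: qbinomial_def)
next
  case False
  with assms have "n \<le> m" "Suc m - n = Suc (m - n)" by auto
  then show ?thesis
    using q_nonzeros(3)[of "m - n"] by (simp add: qbinomial_def qpoch_Suc field_simps del: q_nonzeros(2,3))
qed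

lemma al_salam_carlitz_0: "al_salam_carlitz q c t 0 = 1"
  by (simp add: al_salam_carlitz_def)

lemma al_salam_carlitz_1: "al_salam_carlitz q c t (Suc 0) = 1 + t - c * t"
  using q_nonzeros(2)[of 0] by (simp add: al_salam_carlitz_def qbinomial_def qpoch_Suc field_simps del: q_nonzeros(2))

text \<open>The recurrence holds coefficient by coefficient in \<open>t\<close>: after the \<open>q\<close>-Pascal rule has removed
  \<open>[m+2,n+1]_q\<close> and the terms with \<open>[m+1,n+1]_q\<close> have cancelled, everything left is a multiple
  of \<open>[m+1,n]_q\<close>, and the claim becomes
  \<open>q^{m+1-n} (1 - c q^n) = (1 - c q^{m+1}) - (1 - q^{m+1-n})\<close>.\<close>

lemma al_salam_carlitz_rec:
  "al_salam_carlitz q c t (Suc (Suc m)) =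
     (1 + t - c * t * q ^ Suc m) * al_salam_carlitz q c t (Suc m)
       - t * (1 - q ^ Suc m) * al_salam_carlitz q c t m"
proof -
  define A where "A m n = qbinomial q m n * qpoch c q n * t ^ n" for m n
  have A_0: "A m 0 = 1" for m by (simp add: A_def)
  have A_beyond: "A m (Suc m) = 0" for m by (simp add: A_def qbinomial_def)
  have h: "al_salam_carlitz q c t m = (\<Sum>n\<le>m. A m n)" for m
    by (simp add: al_salam_carlitz_def A_def)
  have step: "A (Suc (Suc m)) (Suc n) =
      A (Suc m) (Suc n) + t * (1 - c * q ^ Suc m) * A (Suc m) n - t * (1 - q ^ Suc m) * A m n"
    if "n \<le> Suc m" for n
  proof -
    have split_power: "q ^ n * q ^ (Suc m - n) = q ^ Suc m"
      using that by (simp flip: power_add)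
    have "A (Suc (Suc m)) (Suc n) =
        A (Suc m) (Suc n) + q ^ (Suc m - n) * (1 - c * q ^ n) * t * A (Suc m) n"
      unfolding A_def qbinomial_pascal[OF that] by (simp add: qpoch_Suc algebra_simps)
    also have "q ^ (Suc m - n) * (1 - c * q ^ n) = (1 - c * q ^ Suc m) - (1 - q ^ (Suc m - n))"
      unfolding split_power[symmetric] by (simp add: algebra_simps)
    also have "\<dots> * t * A (Suc m) n = t * (1 - c * q ^ Suc m) * A (Suc m) n
        - t * ((1 - q ^ (Suc m - n)) * qbinomial q (Suc m) n) * qpoch c q n * t ^ n"
      by (simp add: A_def algebra_simps)
    also have "\<dots> = t * (1 - c * q ^ Suc m) * A (Suc m) n - t * (1 - q ^ Suc m) * A m n"
      unfolding qbinomial_absorb[OF that, symmetric] by (simp add: A_def)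
    finally show ?thesis by simp
  qed
  have "al_salam_carlitz q c t (Suc (Suc m)) = 1 + (\<Sum>n\<le>Suc m. A (Suc (Suc m)) (Suc n))"
    unfolding h by (subst sum.atMost_Suc_shift) (simp add: A_0)
  also have "(\<Sum>n\<le>Suc m. A (Suc (Suc m)) (Suc n)) =
      (\<Sum>n\<le>Suc m. A (Suc m) (Suc n)) + t * (1 - c * q ^ Suc m) * (\<Sum>n\<le>Suc m. A (Suc m) n)
        - t * (1 - q ^ Suc m) * (\<Sum>n\<le>Suc m. A m n)"
    unfolding sum_distrib_left sum.distrib[symmetric] sum_subtractf[symmetric]
    by (intro sum.cong refl step) simp
  also have "(\<Sum>n\<le>Suc m. A (Suc m) (Suc n)) = al_salam_carlitz q c t (Suc m) - 1"
    unfolding h by (subst (2) sum.atMost_Suc_shift) (simp add: A_0 A_beyond)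
  also have "(\<Sum>n\<le>Suc m. A m n) = al_salam_carlitz q c t m"
    unfolding h by (simp add: A_beyond)
  also have "(\<Sum>n\<le>Suc m. A (Suc m) n) = al_salam_carlitz q c t (Suc m)"
    unfolding h ..
  finally show ?thesis by (simp add: algebra_simps)
qed

section \<open>The functional Delta on monomials\<close>

text \<open>The coefficients \<open>b_{n,k} = (q^{-n};q)_k / (q;q)_k\<close> satisfy
  \<open>b_{n+1,k+1} = b_{n,k+1} - q^{-n-1} b_{n,k}\<close>, so raising \<open>n\<close> by one multiplies the generating
  polynomial by \<open>1 - z q^{-n-1}\<close>.\<close>

lemma terminating_q_binomial:
  "(\<Sum>k\<le>n. qpoch (q powi (- int n)) q k / qpoch q q k * z ^ k) = (\<Prod>j<n. 1 - z / q ^ Suc j)"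
proof (induction n)
  case 0
  show ?case by simp
next
  case (Suc n)
  define b where "b n k = qpoch (q powi (- int n)) q k / qpoch q q k" for n k
  have powi: "q powi (- int n) = 1 / q ^ n" for n
    by (simp add: power_int_minus divide_inverse)
  have b_0: "b n 0 = 1" for n by (simp add: b_def)
  have b_beyond: "b n (Suc n) = 0" for n
    using q_nz by (simp add: b_def qpoch_Suc powi)
  have b_step: "b (Suc n) (Suc k) = b n (Suc k) - 1 / q ^ Suc n * b n k" for k
  proof -
    have *: "qpoch (q powi (- int (Suc n))) q (Suc k)
        = (1 - 1 / q ^ Suc n) * qpoch (1 / q ^ n) q k"
      unfolding powi qpoch_Suc_shift using q_nz by simp
    show ?thesis
      unfolding b_def * unfolding powi qpoch_Suc
      using q_nonzeros(1)[of k] q_nonzeros(3)[of k] q_nz by (simp add: divide_simps del: q_nonzeros) (simp add: algebra_simps)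
  qed
  have "(\<Sum>k\<le>Suc n. b (Suc n) k * z ^ k) = 1 + (\<Sum>k\<le>n. b (Suc n) (Suc k) * z ^ Suc k)"
    by (subst sum.atMost_Suc_shift) (simp add: b_0)
  also have "\<dots> = 1 + (\<Sum>k\<le>n. b n (Suc k) * z ^ Suc k) - z / q ^ Suc n * (\<Sum>k\<le>n. b n k * z ^ k)"
    by (simp add: b_step sum_distrib_left sum_subtractf algebra_simps)
  also have "1 + (\<Sum>k\<le>n. b n (Suc k) * z ^ Suc k) = (\<Sum>k\<le>Suc n. b n k * z ^ k)"
    by (subst sum.atMost_Suc_shift) (simp add: b_0)
  also have "\<dots> = (\<Sum>k\<le>n. b n k * z ^ k)"
    by (simp add: b_beyond)
  also have "\<dots> = (\<Prod>j<n. 1 - z / q ^ Suc j)"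
    using Suc.IH by (simp add: b_def)
  finally show ?case by (simp add: b_def algebra_simps)
qed

text \<open>For the monomial \<open>s^m\<close> the generating polynomial is evaluated at \<open>z = q^{m+1}\<close>; if \<open>n > m\<close>,
  then the factor with index \<open>m\<close> vanishes.\<close>

lemma Delta_monomial:
  "Delta q n (\<lambda>s. s ^ m) = (if n \<le> m then qpoch q q m / qpoch q q (m - n) else 0)"
proof -
  have "Delta q n (\<lambda>s. s ^ m) = (\<Prod>j<n. 1 - q ^ Suc m / q ^ Suc j)"
    unfolding Delta_def terminating_q_binomial[symmetric]
    by (simp add: power_mult_distrib power_mult[symmetric] power_add mult_ac flip: power_Suc)
  also have "\<dots> = (if n \<le> m then qpoch q q m / qpoch q q (m - n) else 0)"
  proof (induction n)
    case 0
    show ?case by simp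
  next
    case (Suc n)
    show ?case
    proof (cases "Suc n \<le> m")
      case True
      then obtain d where m: "m = Suc (d + n)"
        by (metis add.commute le_Suc_ex add_Suc)
      have "1 - q ^ Suc m / q ^ Suc n = 1 - q * q ^ d"
        using q_nz by (simp add: m power_add)
      with True show ?thesis
        unfolding prod.lessThan_Suc Suc.IH using q_nonzeros(1)[of d] q_nonzeros(3)[of d]
        by (simp add: m qpoch_Suc[of q d] Suc_diff_le del: q_nonzeros)
    next
      case False
      then consider "n = m" | "n > m" by linarith
      then show ?thesis
        unfolding prod.lessThan_Suc Suc.IH using q_nz by cases simp_all
    qed
  qed
  finally show ?thesis .
qed

section \<open>Moments of the weight\<close>

context
  fixes t :: complex
  assumes t_nz: "t \<noteq> 0"
begin

lemma weight_geometric_tendsto: "(\<lambda>n. weight q c t (v * q ^ n)) \<longlonglongrightarrow> 1"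
proof -
  have "(\<lambda>n. qpoch_inf (v * q / t * q ^ n) q * qpoch_inf (v * q * q ^ n) q
          / qpoch_inf (c * v * q ^ n) q) \<longlonglongrightarrow> 1 * 1 / 1"
    by (intro tendsto_intros qpoch_inf_geometric_tendsto_1) simp
  then show ?thesis by (simp add: weight_def mult_ac)
qed

lemma weight_geometric_bounded: "\<exists>K>0. \<forall>n. norm (weight q c t (v * q ^ n)) \<le> K"
  using weight_geometric_tendsto[THEN convergentI, THEN convergent_imp_Bseq, of c v]
  by (auto simp: Bseq_def)

lemma norm_jackson_term_le:
  assumes "norm (g (1 * q ^ n)) \<le> K" and "norm (g (t * q ^ n)) \<le> K"
  shows "norm (jackson_term q t g n) \<le> K * (1 + norm t) * norm q ^ n"
proof -
  have "norm (jackson_term q t g n)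
      \<le> norm (1 * q ^ n * g (1 * q ^ n)) + norm (t * q ^ n * g (t * q ^ n))"
    unfolding jackson_term_def by (rule norm_triangle_ineq4)
  also have "\<dots> = norm q ^ n * norm (g (1 * q ^ n)) + norm t * norm q ^ n * norm (g (t * q ^ n))"
    by (simp add: norm_mult norm_power)
  also have "\<dots> \<le> norm q ^ n * K + norm t * norm q ^ n * K"
    using assms by (intro add_mono mult_left_mono) auto
  also have "\<dots> = K * (1 + norm t) * norm q ^ n"
    by (simp add: algebra_simps)
  finally show ?thesis .
qed

text \<open>A constant that is uniform in \<open>m\<close> and \<open>n\<close> is what allows summation over the powers
  of \<open>s\<close> and over the nodes to be interchanged.\<close>

lemma moment_term_bound:
  obtains C where "C \<ge> 0"
    "\<And>m n \<rho>. 1 \<le> \<rho> \<Longrightarrow> norm t \<le> \<rho> \<Longrightarrow>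
      norm (jackson_term q t (\<lambda>s. weight q c t s * s ^ m) n) \<le> C * \<rho> ^ m * norm q ^ n"
proof -
  obtain K L where K: "K > 0" "\<And>n. norm (weight q c t (1 * q ^ n)) \<le> K"
    and L: "L > 0" "\<And>n. norm (weight q c t (t * q ^ n)) \<le> L"
    using weight_geometric_bounded[of c 1] weight_geometric_bounded[of c t] by metis
  have "norm (jackson_term q t (\<lambda>s. weight q c t s * s ^ m) n)
      \<le> max K L * (1 + norm t) * \<rho> ^ m * norm q ^ n" if "1 \<le> \<rho>" "norm t \<le> \<rho>" for m n \<rho>
  proof -
    have bound: "norm (weight q c t (v * q ^ n) * (v * q ^ n) ^ m) \<le> max K L * \<rho> ^ m"
      if "norm v \<le> \<rho>" "norm (weight q c t (v * q ^ n)) \<le> max K L" for v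
    proof -
      have "norm v * norm q ^ n \<le> \<rho> * 1"
        using that q_lt \<open>1 \<le> \<rho>\<close> by (intro mult_mono power_le_one) auto
      then have "(norm (v * q ^ n)) ^ m \<le> \<rho> ^ m"
        by (intro power_mono) (simp_all add: norm_mult norm_power)
      with that(2) show ?thesis
        unfolding norm_mult norm_power using K(1) by (intro mult_mono) auto
    qed
    have "norm (jackson_term q t (\<lambda>s. weight q c t s * s ^ m) n)
        \<le> (max K L * \<rho> ^ m) * (1 + norm t) * norm q ^ n"
      using bound[of 1] bound[of t] that K(2)[of n] L(2)[of n]
      by (intro norm_jackson_term_le) (simp_all add: le_max_iff_disj)
    then show ?thesis by (simp only: mult.assoc mult.commute[of "1 + norm t"])
  qed
  then show ?thesis using that[of "max K L * (1 + norm t)"] K(1) by simp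
qed

lemma moment_term_summable:
  "summable (\<lambda>n. norm (jackson_term q t (\<lambda>s. weight q c t s * s ^ m) n))"
proof -
  obtain C where C: "\<And>n. norm (jackson_term q t (\<lambda>s. weight q c t s * s ^ m) n)
      \<le> C * max 1 (norm t) ^ m * norm q ^ n"
    using moment_term_bound[of c] by (metis max.cobounded1 max.cobounded2)
  have "summable (\<lambda>n. C * max 1 (norm t) ^ m * norm q ^ n)"
    using q_lt by (intro summable_mult summable_geometric) auto
  then show ?thesis
    by (rule summable_comparison_test'[where N = 0]) (use C in \<open>simp only: real_norm_def abs_norm_cancel\<close>)
qed

lemma moment_sums:
  "jackson_term q t (\<lambda>s. weight q c t s * s ^ m) sums moment q c t m"
  unfolding moment_def by (rule summable_sums[OF summable_norm_cancel[OF moment_term_summable]])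

text \<open>Along both progressions the primitive has the same limit \<open>0^m\<close>, and it starts from \<open>0\<close>
  because \<open>(1;q)_\<infinity> = 0\<close> occurs among its factors at \<open>s = 1\<close> and at \<open>s = t\<close>.\<close>

lemma q_primitive_telescopes:
  "(\<lambda>n. (q_primitive q c t m (1 * q ^ n) - q_primitive q c t m (1 * q ^ Suc n))
      - (q_primitive q c t m (t * q ^ n) - q_primitive q c t m (t * q ^ Suc n))) sums 0"
proof -
  have lim: "(\<lambda>n. q_primitive q c t m (v * q ^ n)) \<longlonglongrightarrow> 0 ^ m" for v
  proof -
    have "(\<lambda>n. (v * q ^ n) ^ m * (qpoch_inf (v / t * q ^ n) q * qpoch_inf (v * q ^ n) q
          / qpoch_inf (c * v * q ^ n) q)) \<longlonglongrightarrow> 0 ^ m * (1 * 1 / 1)"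
      by (intro tendsto_intros qpoch_inf_geometric_tendsto_1 power_q_tendsto_0) simp
    then show ?thesis by (simp add: q_primitive_def mult_ac)
  qed
  have tele: "(\<lambda>n. q_primitive q c t m (v * q ^ n) - q_primitive q c t m (v * q ^ Suc n))
      sums (q_primitive q c t m v - 0 ^ m)" for v
    using telescope_sums'[OF lim[of v]] by simp
  have "q_primitive q c t m 1 = 0" "q_primitive q c t m t = 0"
    using t_nz qpoch_inf_1 by (simp_all add: q_primitive_def)
  then show ?thesis
    using sums_diff[OF tele[of 1] tele[of t]] by simp
qed

text \<open>The \<open>q\<close>-difference equation of the weight: \<open>s \<mapsto> sq\<close> removes one factor from each of the
  three infinite products.\<close>

lemma q_primitive_difference:
  assumes nz: "qpoch_inf (c * s) q \<noteq> 0"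
  shows "q_primitive q c t m s - q_primitive q c t m (s * q)
      = weight q c t s * s ^ m * ((1 - s / t) * (1 - s) - q ^ m * (1 - c * s))"
proof -
  have nz': "1 - c * s \<noteq> 0" "qpoch_inf (c * s * q) q \<noteq> 0"
    using nz unfolding qpoch_inf_step[of "c * s"] by auto
  have "weight q c t s * (1 - c * s)
      = qpoch_inf (s * q / t) q * qpoch_inf (s * q) q / qpoch_inf (c * (s * q)) q"
    unfolding weight_def qpoch_inf_step[of "c * s"] using nz' by (simp add: mult.assoc)
  then have "q_primitive q c t m (s * q) = (s * q) ^ m * (weight q c t s * (1 - c * s))"
    unfolding q_primitive_def by (simp only:)
  then have "q_primitive q c t m (s * q) = weight q c t s * s ^ m * (q ^ m * (1 - c * s))"
    by (simp only: power_mult_distrib mult_ac)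
  moreover have "q_primitive q c t m s = weight q c t s * s ^ m * ((1 - s / t) * (1 - s))"
    unfolding q_primitive_def weight_def qpoch_inf_step[of "s / t"] qpoch_inf_step[of s] by simp
  ultimately show ?thesis by (simp only: right_diff_distrib)
qed

context
  fixes c :: complex
  assumes c_nz: "\<And>n. qpoch_inf (c * q ^ n) q \<noteq> 0"
    and ct_nz: "\<And>n. qpoch_inf (c * (t * q ^ n)) q \<noteq> 0"
begin

text \<open>Integration of a total \<open>q\<close>-difference.  For \<open>m = 0\<close> the index \<open>m - 1\<close> is truncated to
  \<open>0\<close>, which is harmless since the coefficient \<open>1 - q^m\<close> is then \<open>0\<close>.\<close>

lemma moment_relation:
  "(1 - q ^ m) * moment q c t (m - 1) - (1 + 1 / t - c * q ^ m) * moment q c t m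
     + moment q c t (Suc m) / t = 0"
proof -
  let ?T = "\<lambda>m. jackson_term q t (\<lambda>s. weight q c t s * s ^ m)"
  let ?G = "\<lambda>s. weight q c t s * s ^ m * ((1 - s / t) * (1 - s) - q ^ m * (1 - c * s))"
  have G: "?G s = (1 - q ^ m) * (s * (weight q c t s * s ^ (m - 1)))
      - (1 + 1 / t - c * q ^ m) * (s * (weight q c t s * s ^ m))
      + (s * (weight q c t s * s ^ Suc m)) / t" for s
    by (cases m) (simp_all add: algebra_simps divide_simps)
  have "(1 - q ^ m) * ?T (m - 1) n - (1 + 1 / t - c * q ^ m) * ?T m n + ?T (Suc m) n / t
      = ?G (1 * q ^ n) - ?G (t * q ^ n)" for n
    unfolding G jackson_term_def
    by (simp only: right_diff_distrib diff_divide_distrib) (simp only: algebra_simps)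
  also have "?G (1 * q ^ n) - ?G (t * q ^ n)
      = (q_primitive q c t m (1 * q ^ n) - q_primitive q c t m (1 * q ^ Suc n))
      - (q_primitive q c t m (t * q ^ n) - q_primitive q c t m (t * q ^ Suc n))" for n
    using q_primitive_difference[of c "1 * q ^ n" m] q_primitive_difference[of c "t * q ^ n" m]
      c_nz[of n] ct_nz[of n] by (simp add: mult_ac)
  finally have "(\<lambda>n. (1 - q ^ m) * ?T (m - 1) n - (1 + 1 / t - c * q ^ m) * ?T m n
      + ?T (Suc m) n / t) sums 0"
    using q_primitive_telescopes[of c m] by simp
  moreover have "(\<lambda>n. (1 - q ^ m) * ?T (m - 1) n - (1 + 1 / t - c * q ^ m) * ?T m n
      + ?T (Suc m) n / t) sums ((1 - q ^ m) * moment q c t (m - 1)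
        - (1 + 1 / t - c * q ^ m) * moment q c t m + moment q c t (Suc m) / t)"
    by (intro sums_add sums_diff sums_mult sums_divide moment_sums)
  ultimately show ?thesis by (rule sums_unique2[symmetric])
qed

lemma moment_eq_al_salam_carlitz:
  "moment q c t m = moment q c t 0 * al_salam_carlitz q c t m"
proof -
  have rec: "moment q c t (Suc m) = (1 + t - c * t * q ^ m) * moment q c t m
      - t * (1 - q ^ m) * moment q c t (m - 1)" for m
    using moment_relation[of m] t_nz by (simp add: field_simps)
  show ?thesis
  proof (induction m rule: less_induct)
    case (less m)
    show ?case
    proof (cases m)
      case 0
      then show ?thesis by (simp add: al_salam_carlitz_0)
    next
      case (Suc k)
      show ?thesis
      proof (cases k)
        case 0
        then show ?thesis
          using rec[of 0] by (simp add: Suc al_salam_carlitz_1)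
      next
        case (Suc l)
        have m: "m = Suc (Suc l)" using Suc \<open>m = Suc k\<close> by simp
        show ?thesis
          unfolding m rec[of "Suc l"] al_salam_carlitz_rec
          using less.IH[of l] less.IH[of "Suc l"] by (simp add: m algebra_simps)
      qed
    qed
  qed
qed

text \<open>Replacing \<open>c\<close> by \<open>cq\<close> multiplies the weight by \<open>1 - cs\<close>, so the new mass is
  \<open>M_0 - c M_1\<close>, and \<open>M_1 = (1 + t - ct) M_0\<close>.\<close>

lemma moment_0_shift:
  "moment q (c * q) t 0 = (1 - c) * (1 - c * t) * moment q c t 0"
proof -
  have shift: "weight q (c * q) t s = weight q c t s * (1 - c * s)"
    if "qpoch_inf (c * s) q \<noteq> 0" for s
  proof -
    have "1 - c * s \<noteq> 0" "qpoch_inf (c * s * q) q \<noteq> 0"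
      using that unfolding qpoch_inf_step[of "c * s"] by auto
    then show ?thesis unfolding weight_def qpoch_inf_step[of "c * s"] by (simp add: mult_ac)
  qed
  have "jackson_term q t (\<lambda>s. weight q (c * q) t s * s ^ 0) n
      = jackson_term q t (\<lambda>s. weight q c t s * s ^ 0) n
        - c * jackson_term q t (\<lambda>s. weight q c t s * s ^ 1) n" for n
  proof -
    have w: "weight q (c * q) t (1 * q ^ n) = weight q c t (1 * q ^ n) * (1 - c * (1 * q ^ n))"
      "weight q (c * q) t (t * q ^ n) = weight q c t (t * q ^ n) * (1 - c * (t * q ^ n))"
      using c_nz[of n] ct_nz[of n] by (auto intro!: shift)
    show ?thesis unfolding jackson_term_def w by (simp add: algebra_simps)
  qed
  then have expand: "jackson_term q t (\<lambda>s. weight q (c * q) t s * s ^ 0)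
      = (\<lambda>n. jackson_term q t (\<lambda>s. weight q c t s * s ^ 0) n
        - c * jackson_term q t (\<lambda>s. weight q c t s * s ^ 1) n)"
    by (rule ext)
  have "jackson_term q t (\<lambda>s. weight q (c * q) t s * s ^ 0)
      sums (moment q c t 0 - c * moment q c t 1)"
    unfolding expand by (intro sums_diff sums_mult moment_sums)
  then have "moment q (c * q) t 0 = moment q c t 0 - c * moment q c t 1"
    using moment_sums[of "c * q" 0] by (metis sums_unique2)
  also have "moment q c t 1 = (1 + t - c * t) * moment q c t 0"
    using moment_eq_al_salam_carlitz[of 1] by (simp add: al_salam_carlitz_1)
  finally show ?thesis by (simp add: algebra_simps)
qed

end

section \<open>The total mass of the weight\<close>

text \<open>The parameters \<open>c q^N\<close> enter at the \<open>k\<close>-th node \<open>v q^k\<close> only through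
  \<open>1 / (c v q^{N+k};q)_\<infinity>\<close>, a convergent and hence bounded sequence in \<open>N + k\<close>.  So the terms are
  dominated by a geometric series uniformly in \<open>N\<close>, and Tannery's theorem applies.\<close>

lemma moment_0_tendsto: "(\<lambda>N. moment q (c * q ^ N) t 0) \<longlonglongrightarrow> moment q 0 t 0"
proof -
  define r where "r v n = inverse (qpoch_inf (c * v * q ^ n) q)" for v n
  have r_lim: "r v \<longlonglongrightarrow> 1" for v
    unfolding r_def
    using tendsto_inverse[OF qpoch_inf_geometric_tendsto_1[of "c * v"]] by simp
  have r_bound: "\<exists>L>0. \<forall>n. norm (r v n) \<le> L" for v
    using r_lim[THEN convergentI, THEN convergent_imp_Bseq] by (auto simp: Bseq_def)
  have factor: "weight q (c * q ^ N) t (v * q ^ k) = weight q 0 t (v * q ^ k) * r v (N + k)" for N v k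
    by (simp add: weight_def r_def qpoch_inf_0 divide_inverse power_add mult_ac)
  have "\<exists>K. \<forall>N k. norm (weight q (c * q ^ N) t (v * q ^ k)) \<le> K" for v
  proof -
    obtain K L where K: "K > 0" "\<And>n. norm (weight q 0 t (v * q ^ n)) \<le> K"
      and L: "L > 0" "\<And>n. norm (r v n) \<le> L"
      using weight_geometric_bounded[of 0 v] r_bound[of v] by metis
    have "norm (weight q (c * q ^ N) t (v * q ^ k)) \<le> K * L" for N k
      unfolding factor norm_mult using K L by (intro mult_mono) auto
    then show ?thesis by blast
  qed
  then obtain K where K: "\<And>v N k. norm (weight q (c * q ^ N) t (v * q ^ k)) \<le> K v"
    by metis
  let ?a = "\<lambda>k N. jackson_term q t (\<lambda>s. weight q (c * q ^ N) t s * s ^ 0) k"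
  let ?b = "jackson_term q t (\<lambda>s. weight q 0 t s * s ^ 0)"
  let ?M = "\<lambda>k. max (K 1) (K t) * (1 + norm t) * norm q ^ k"
  have bound: "norm (?a k N) \<le> ?M k" for k N
    using K[of N 1 k] K[of N t k]
    by (intro norm_jackson_term_le) (auto simp: le_max_iff_disj)
  have weight_lim: "(\<lambda>N. weight q (c * q ^ N) t (v * q ^ k)) \<longlonglongrightarrow> weight q 0 t (v * q ^ k)" for v k
    unfolding factor
    using tendsto_mult[OF tendsto_const LIMSEQ_ignore_initial_segment[OF r_lim[of v], of k]] by simp
  have lim: "(\<lambda>N. ?a k N) \<longlonglongrightarrow> ?b k" for k
    unfolding jackson_term_def by (intro tendsto_intros weight_lim)
  have "(\<lambda>N. \<Sum>k. ?a k N) \<longlonglongrightarrow> (\<Sum>k. ?b k)"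
  proof -
    have "summable ?M" using q_lt by (intro summable_mult summable_geometric) auto
    moreover have "eventually (\<lambda>(k, N). norm (?a k N) \<le> ?M k) (at_top \<times>\<^sub>F sequentially)"
      using bound by (intro always_eventually) auto
    ultimately show ?thesis
      using tannerys_theorem[of ?a ?b sequentially ?M] lim by simp
  qed
  then show ?thesis by (simp only: moment_def)
qed

text \<open>The left-hand side is invariant under \<open>c \<mapsto> cq\<close>, and along \<open>c q^N\<close> it tends to the
  right-hand side.  Thus the product does not depend on \<open>c\<close>.\<close>

lemma moment_0_invariant:
  assumes c_nz: "\<And>n. qpoch_inf (c * q ^ n) q \<noteq> 0"
    and ct_nz: "\<And>n. qpoch_inf (c * (t * q ^ n)) q \<noteq> 0"
  shows "moment q c t 0 * (qpoch_inf c q * qpoch_inf (c * t) q) = moment q 0 t 0"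
proof -
  define I where "I N = moment q (c * q ^ N) t 0
      * (qpoch_inf (c * q ^ N) q * qpoch_inf (c * t * q ^ N) q)" for N
  have step: "I (Suc N) = I N" for N
  proof -
    have "moment q (c * q ^ N * q) t 0
        = (1 - c * q ^ N) * (1 - c * q ^ N * t) * moment q (c * q ^ N) t 0"
      using c_nz[of "N + n" for n] ct_nz[of "N + n" for n]
      by (intro moment_0_shift) (simp_all add: power_add mult_ac)
    then show ?thesis
      unfolding I_def qpoch_inf_step[of "c * q ^ N"]
        qpoch_inf_step[of "c * t * q ^ N"]
      by (simp add: mult_ac)
  qed
  define J where "J = I 0"
  have const: "I N = J" for N by (induction N) (simp_all add: J_def step)
  have "(\<lambda>N. I N) \<longlonglongrightarrow> moment q 0 t 0 * (1 * 1)"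
    unfolding I_def
    by (intro tendsto_mult moment_0_tendsto qpoch_inf_geometric_tendsto_1)
  then have "J = moment q 0 t 0"
    unfolding const by (simp add: LIMSEQ_const_iff)
  then show ?thesis by (simp add: J_def I_def)
qed

text \<open>For \<open>c = q\<close> the weight is just \<open>(sq/t;q)_\<infinity>\<close>, and
  \<open>x (xq;q)_\<infinity> = (xq;q)_\<infinity> - (x;q)_\<infinity>\<close> makes the series telescope.\<close>

lemma moment_0_special:
  assumes t: "qpoch_inf t q \<noteq> 0"
  shows "moment q q t 0 = (1 - t) * qpoch_inf (q / t) q"
proof -
  have nz: "qpoch_inf (q * (1 * q ^ n)) q \<noteq> 0" "qpoch_inf (q * (t * q ^ n)) q \<noteq> 0" for n
    using qpoch_inf_geometric_nonzero[of q n] qpoch_inf_geometric_nonzero[OF t, of "Suc n"]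
    by (simp_all add: mult_ac)
  have weight: "weight q q t s = qpoch_inf (s / t * q) q" if "qpoch_inf (q * s) q \<noteq> 0" for s
    using that by (simp add: weight_def mult_ac)
  have diff: "x * qpoch_inf (x * q) q = qpoch_inf (x * q) q - qpoch_inf x q" for x
    by (subst (3) qpoch_inf_step) (simp add: algebra_simps)
  define A where "A v n = qpoch_inf (v * q ^ n) q" for v n
  have expand: "jackson_term q t (\<lambda>s. weight q q t s * s ^ 0) n
      = t * (A (1 / t) (Suc n) - A (1 / t) n) - t * (A 1 (Suc n) - A 1 n)" for n
  proof -
    have "1 * q ^ n * qpoch_inf (1 * q ^ n / t * q) q = t * (A (1 / t) (Suc n) - A (1 / t) n)"
      using diff[of "1 / t * q ^ n"] t_nz by (simp add: A_def field_simps)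
    moreover have "t * q ^ n * qpoch_inf (t * q ^ n / t * q) q = t * (A 1 (Suc n) - A 1 n)"
      using arg_cong[OF diff[of "q ^ n"], of "(*) t"] t_nz by (simp add: A_def mult_ac)
    ultimately show ?thesis
      unfolding jackson_term_def weight[OF nz(1)] weight[OF nz(2)] by (simp only: power_0 mult_1_right)
  qed
  have "(\<lambda>n. t * (A (1 / t) (Suc n) - A (1 / t) n) - t * (A 1 (Suc n) - A 1 n))
      sums (t * (1 - A (1 / t) 0) - t * (1 - A 1 0))"
    unfolding A_def
    by (intro sums_diff sums_mult telescope_sums qpoch_inf_geometric_tendsto_1)
  then have "moment q q t 0 = t * (1 - A (1 / t) 0) - t * (1 - A 1 0)"
    unfolding moment_def expand by (rule sums_unique[symmetric])
  also have "A 1 0 = 0" by (simp add: A_def qpoch_inf_1)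
  also have "A (1 / t) 0 = (1 - 1 / t) * qpoch_inf (q / t) q"
    using qpoch_inf_step[of "1 / t"] by (simp add: A_def)
  also have "t * (1 - (1 - 1 / t) * qpoch_inf (q / t) q) - t * (1 - 0) = (1 - t) * qpoch_inf (q / t) q"
    using t_nz by (simp add: field_simps)
  finally show ?thesis .
qed

text \<open>By the independence of \<open>c\<close>, the general mass is determined by the one at \<open>c = q\<close>.  This is a
  one-parameter case of the Andrews--Askey \<open>q\<close>-beta integral.\<close>

theorem moment_0_eval:
  assumes t: "qpoch_inf t q \<noteq> 0"
    and c_nz: "\<And>n. qpoch_inf (c * q ^ n) q \<noteq> 0"
    and ct_nz: "\<And>n. qpoch_inf (c * (t * q ^ n)) q \<noteq> 0"
  shows "moment q c t 0 * (qpoch_inf c q * qpoch_inf (c * t) q)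
    = qpoch_inf q q * qpoch_inf t q * qpoch_inf (q / t) q"
proof -
  have nz: "qpoch_inf (q * q ^ n) q \<noteq> 0" "qpoch_inf (q * (t * q ^ n)) q \<noteq> 0" for n
    using qpoch_inf_geometric_nonzero[of q n] qpoch_inf_geometric_nonzero[OF t, of "Suc n"]
    by (simp_all add: mult_ac)
  have "moment q c t 0 * (qpoch_inf c q * qpoch_inf (c * t) q)
      = moment q q t 0 * (qpoch_inf q q * qpoch_inf (q * t) q)"
    unfolding moment_0_invariant[OF c_nz ct_nz] moment_0_invariant[OF nz] ..
  also have "\<dots> = qpoch_inf q q * ((1 - t) * qpoch_inf (t * q) q) * qpoch_inf (q / t) q"
    unfolding moment_0_special[OF t] by (simp add: mult_ac)
  also have "(1 - t) * qpoch_inf (t * q) q = qpoch_inf t q"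
    by (rule qpoch_inf_step[symmetric])
  finally show ?thesis .
qed

section \<open>Expansion in powers\<close>

text \<open>The radius \<open>\<rho>\<close> dominates every node of the Jackson integral and is smaller than the radius of
  convergence.  It is taken strictly larger than \<open>1\<close> so that the partial sums of \<open>\<rho>^n\<close> up to
  \<open>n = m\<close> are bounded by a constant times \<open>\<rho>^m\<close>.\<close>

context
  fixes c :: complex and f :: "complex \<Rightarrow> complex" and a :: "nat \<Rightarrow> complex" and R \<rho> :: real
  assumes f_series: "\<And>s. norm s < R \<Longrightarrow> (\<lambda>m. a m * s ^ m) sums f s"
    and \<rho>: "1 < \<rho>" "norm t \<le> \<rho>" "\<rho> < R"
begin

lemma coefficients_summable: "summable (\<lambda>m. norm (a m) * \<rho> ^ m)"
proof -
  define r where "r = (\<rho> + R) / 2"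
  have r: "\<rho> < r" "r < R" using \<rho> by (auto simp: r_def)
  have "summable (\<lambda>m. a m * of_real r ^ m)"
    using f_series[of "of_real r"] r \<rho> by (auto intro: sums_summable)
  then have "summable (\<lambda>m. norm (a m * of_real \<rho> ^ m))"
    by (rule powser_insidea) (use r \<rho> in auto)
  then show ?thesis using \<rho> by (simp add: norm_mult norm_power)
qed

lemma jackson_sum_expansion:
  "jackson_term q t (\<lambda>s. weight q c t s * f s) sums (\<Sum>m. a m * moment q c t m)"
proof -
  let ?T = "\<lambda>m. jackson_term q t (\<lambda>s. weight q c t s * s ^ m)"
  obtain C where "C \<ge> 0"
    and C': "\<And>m n \<rho>. 1 \<le> \<rho> \<Longrightarrow> norm t \<le> \<rho> \<Longrightarrow> norm (?T m n) \<le> C * \<rho> ^ m * norm q ^ n"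
    using moment_term_bound[of c] by metis
  have C: "norm (?T m n) \<le> C * \<rho> ^ m * norm q ^ n" for m n
    using C' \<rho> by simp
  have summ: "summable (\<lambda>n. norm (?T m n))" for m
    by (rule moment_term_summable)
  have row_norm: "summable (\<lambda>n. norm (a m * ?T m n))" for m
    unfolding norm_mult by (intro summable_mult summ)
  have "(\<Sum>n. norm (a m * ?T m n)) \<le> C / (1 - norm q) * (norm (a m) * \<rho> ^ m)" for m
  proof -
    have "(\<Sum>n. norm (?T m n)) \<le> (\<Sum>n. C * \<rho> ^ m * norm q ^ n)"
      using q_lt by (intro suminf_le C summ summable_mult summable_geometric) auto
    also have "\<dots> = C * \<rho> ^ m * (1 / (1 - norm q))"
      using q_lt by (subst suminf_mult) (auto intro: summable_geometric simp: suminf_geometric)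
    finally have "norm (a m) * (\<Sum>n. norm (?T m n))
        \<le> norm (a m) * (C * \<rho> ^ m * (1 / (1 - norm q)))"
      by (rule mult_left_mono) simp
    then show ?thesis
      unfolding norm_mult suminf_mult[OF summ] by (simp add: mult_ac)
  qed
  from sums_swap(1)[of "\<lambda>m n. a m * ?T m n", OF row_norm this
      summable_mult[OF coefficients_summable]]
  have sums: "(\<lambda>n. \<Sum>m. a m * ?T m n) sums (\<Sum>m. \<Sum>n. a m * ?T m n)" .
  have "(\<Sum>n. a m * ?T m n) = a m * moment q c t m" for m
    by (rule sums_unique[symmetric, OF sums_mult[OF moment_sums]])
  moreover have "(\<Sum>m. a m * ?T m n) = jackson_term q t (\<lambda>s. weight q c t s * f s) n" for n
  proof -
    have in_disc: "norm (1 * q ^ n) < R" "norm (t * q ^ n) < R"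
    proof -
      have "norm q ^ n \<le> 1" using q_lt by (intro power_le_one) auto
      then have "norm t * norm q ^ n \<le> norm t * 1" by (intro mult_left_mono) auto
      with \<open>norm q ^ n \<le> 1\<close> \<rho> show "norm (1 * q ^ n) < R" "norm (t * q ^ n) < R"
        by (simp_all add: norm_mult norm_power)
    qed
    have "(\<lambda>m. 1 * q ^ n * weight q c t (1 * q ^ n) * (a m * (1 * q ^ n) ^ m)
        - t * q ^ n * weight q c t (t * q ^ n) * (a m * (t * q ^ n) ^ m)) sums
      (1 * q ^ n * weight q c t (1 * q ^ n) * f (1 * q ^ n)
        - t * q ^ n * weight q c t (t * q ^ n) * f (t * q ^ n))"
      by (intro sums_diff sums_mult f_series in_disc)
    then have "(\<lambda>m. a m * ?T m n) sums jackson_term q t (\<lambda>s. weight q c t s * f s) n"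
      by (simp add: jackson_term_def algebra_simps)
    then show ?thesis by (rule sums_unique[symmetric])
  qed
  ultimately show ?thesis using sums by simp
qed

text \<open>The sequence \<open>(q;q)_n\<close> converges to a nonzero limit, so it and its reciprocals are
  bounded.\<close>

lemma qbinomial_bounded:
  "\<exists>K>0. \<forall>m n. norm (qbinomial q m n * qpoch c q n) \<le> K"
proof -
  have bdd: "\<exists>K>0. \<forall>n. norm (qpoch x q n) \<le> K" for x
    using qpoch_tendsto[of x, THEN convergentI, THEN convergent_imp_Bseq]
    by (auto simp: Bseq_def)
  have "(\<lambda>n. inverse (qpoch q q n)) \<longlonglongrightarrow> inverse (qpoch_inf q q)"
    by (intro tendsto_inverse qpoch_tendsto qpoch_q_inf_nonzero)
  from convergent_imp_Bseq[OF convergentI[OF this]]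
  have "\<exists>K>0. \<forall>n. norm (inverse (qpoch q q n)) \<le> K" by (simp only: Bseq_def)
  then obtain I where I: "I > 0" "\<And>n. norm (inverse (qpoch q q n)) \<le> I" by metis
  obtain K where K: "K > 0" "\<And>n. norm (qpoch q q n) \<le> K" using bdd[of q] by metis
  obtain L where L: "L > 0" "\<And>n. norm (qpoch c q n) \<le> L" using bdd[of c] by metis
  have "norm (qbinomial q m n * qpoch c q n) \<le> K * (I * I) * L" for m n
  proof (cases "n \<le> m")
    case True
    then have eq: "qbinomial q m n * qpoch c q n
        = qpoch q q m * (inverse (qpoch q q n) * inverse (qpoch q q (m - n))) * qpoch c q n"
      by (simp add: qbinomial_def divide_inverse)
    show ?thesis
      unfolding eq norm_mult
      by (intro mult_mono I(2) K(2) L(2) mult_nonneg_nonneg norm_ge_zero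
          less_imp_le[OF I(1)] less_imp_le[OF K(1)])
  qed (use I K L in \<open>simp add: qbinomial_def\<close>)
  moreover have "K * (I * I) * L > 0" using I K L by simp
  ultimately show ?thesis by blast
qed

lemma Delta_expansion: "(\<lambda>m. a m * Delta q n (\<lambda>s. s ^ m)) sums Delta q n f"
proof -
  have "norm (q ^ k) < R" for k
    using power_le_one[of "norm q" k] q_lt \<rho> by (simp add: norm_power)
  then have "(\<lambda>m. \<Sum>k\<le>n. qpoch (q powi (- int n)) q k / qpoch q q k * q ^ k * (a m * (q ^ k) ^ m))
      sums (\<Sum>k\<le>n. qpoch (q powi (- int n)) q k / qpoch q q k * q ^ k * f (q ^ k))"
    by (intro sums_sum sums_mult f_series)
  moreover have "(\<Sum>k\<le>n. qpoch (q powi (- int n)) q k / qpoch q q k * q ^ k * (a m * (q ^ k) ^ m))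
      = a m * Delta q n (\<lambda>s. s ^ m)" for m
    unfolding Delta_def sum_distrib_left by (intro sum.cong refl) (simp add: mult_ac)
  moreover have "(\<Sum>k\<le>n. qpoch (q powi (- int n)) q k / qpoch q q k * q ^ k * f (q ^ k))
      = Delta q n f"
    unfolding Delta_def by (intro sum.cong refl) (simp add: mult_ac)
  ultimately show ?thesis by simp
qed

text \<open>The array of terms is triangular.  Summing it by columns gives the left-hand side of the
  identity, and summing it by rows gives the Al-Salam--Carlitz polynomials.\<close>

lemma Delta_sum_expansion:
  "(\<lambda>n. qpoch c q n / qpoch q q n * t ^ n * Delta q n f)
     sums (\<Sum>m. a m * al_salam_carlitz q c t m)"
  "summable (\<lambda>m. a m * al_salam_carlitz q c t m)"
proof -
  let ?A = "\<lambda>m n. a m * (qbinomial q m n * qpoch c q n * t ^ n)"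
  obtain K where K: "K > 0" "\<And>m n. norm (qbinomial q m n * qpoch c q n) \<le> K"
    using qbinomial_bounded by metis
  have beyond: "?A m n = 0" if "n \<notin> {..m}" for m n
    using that by (simp add: qbinomial_def)
  have row: "(\<lambda>n. ?A m n) sums (a m * al_salam_carlitz q c t m)" for m
    using sums_finite[of "{..m}" "?A m"] beyond
    by (simp add: al_salam_carlitz_def sum_distrib_left)
  have row_norm: "(\<lambda>n. norm (?A m n)) sums (\<Sum>n\<le>m. norm (?A m n))" for m
    using beyond by (intro sums_finite) auto
  have row_bound: "(\<Sum>n. norm (?A m n)) \<le> K * \<rho> / (\<rho> - 1) * (norm (a m) * \<rho> ^ m)" for m
  proof -
    have "(\<Sum>n. norm (?A m n)) = (\<Sum>n\<le>m. norm (?A m n))"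
      using row_norm by (rule sums_unique[symmetric])
    also have "\<dots> \<le> (\<Sum>n\<le>m. norm (a m) * (K * \<rho> ^ n))"
    proof (intro sum_mono)
      fix n
      have "norm (qbinomial q m n * qpoch c q n) * norm (t ^ n) \<le> K * \<rho> ^ n"
        using K \<rho> by (intro mult_mono) (auto simp: norm_power intro: power_mono)
      then show "norm (?A m n) \<le> norm (a m) * (K * \<rho> ^ n)"
        by (simp only: norm_mult mult_left_mono norm_ge_zero)
    qed
    also have "\<dots> = norm (a m) * K * (\<Sum>n\<le>m. \<rho> ^ n)"
      by (simp add: sum_distrib_left mult_ac)
    also have "\<dots> \<le> norm (a m) * K * (\<rho> ^ Suc m / (\<rho> - 1))"
    proof (rule mult_left_mono)
      have "(\<Sum>n\<le>m. \<rho> ^ n) = (\<rho> ^ Suc m - 1) / (\<rho> - 1)"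
        using \<rho> geometric_sum[of \<rho> "Suc m"] by (simp add: lessThan_Suc_atMost)
      also have "\<dots> \<le> \<rho> ^ Suc m / (\<rho> - 1)"
        using \<rho> by (intro divide_right_mono) auto
      finally show "(\<Sum>n\<le>m. \<rho> ^ n) \<le> \<rho> ^ Suc m / (\<rho> - 1)" .
    qed (use K in simp)
    also have "\<dots> = K * \<rho> / (\<rho> - 1) * (norm (a m) * \<rho> ^ m)"
      by simp
    finally show ?thesis .
  qed
  note swap = sums_swap[of ?A, OF sums_summable[OF row_norm] row_bound
      summable_mult[OF coefficients_summable]]
  have column: "(\<Sum>m. ?A m n) = qpoch c q n / qpoch q q n * t ^ n * Delta q n f" for n
  proof -
    have "?A m n = qpoch c q n / qpoch q q n * t ^ n * (a m * Delta q n (\<lambda>s. s ^ m))" for m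
      unfolding Delta_monomial by (simp add: qbinomial_def mult_ac)
    then have A: "(\<lambda>m. ?A m n)
        = (\<lambda>m. qpoch c q n / qpoch q q n * t ^ n * (a m * Delta q n (\<lambda>s. s ^ m)))"
      by (rule ext)
    show ?thesis
      unfolding A by (rule sums_unique[symmetric, OF sums_mult[OF Delta_expansion]])
  qed
  show "(\<lambda>n. qpoch c q n / qpoch q q n * t ^ n * Delta q n f)
     sums (\<Sum>m. a m * al_salam_carlitz q c t m)"
    using swap(1) unfolding column sums_unique[OF row, symmetric] .
  show "summable (\<lambda>m. a m * al_salam_carlitz q c t m)"
    using swap(2) unfolding sums_unique[OF row, symmetric] .
qed

end

end

end

theorem theorem3p2:
  fixes q c t :: complex and R :: real and f :: "complex \<Rightarrow> complex"
  assumes "0 < norm q" and "norm q < 1"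
    and "R > 1" and "f holomorphic_on ball 0 R"
    and "norm t < R"
    and "t \<noteq> 0" and "qpoch_inf t q \<noteq> 0" and "qpoch_inf (q / t) q \<noteq> 0"
    and "\<And>n. qpoch_inf (c * q ^ n) q \<noteq> 0"
    and "\<And>n. qpoch_inf (c * (t * q ^ n)) q \<noteq> 0"
  shows "jackson_integrable q t 1
           (\<lambda>s. qpoch_inf (s * q / t) q * qpoch_inf (s * q) q / qpoch_inf (c * s) q * f s) \<and>
         (\<lambda>n. qpoch c q n / qpoch q q n * t ^ n * Delta q n f) sums
           (qpoch_inf c q * qpoch_inf (c * t) q
              / (qpoch_inf q q * qpoch_inf t q * qpoch_inf (q / t) q)
            * jackson_integral q t 1
                (\<lambda>s. qpoch_inf (s * q / t) q * qpoch_inf (s * q) q / qpoch_inf (c * s) q * f s))"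
proof -
  let ?g = "\<lambda>s. weight q c t s * f s"
  have q_nz: "q \<noteq> 0" using assms(1) by auto
  note q_lt = assms(2) and t_nz = assms(6)
  define a where "a m = (deriv ^^ m) f 0 / fact m" for m
  have f_series: "(\<lambda>m. a m * s ^ m) sums f s" if "norm s < R" for s
    using holomorphic_power_series[OF assms(4), of s] that by (simp add: a_def)
  obtain \<rho> where \<rho>: "max 1 (norm t) < \<rho>" "\<rho> < R"
    using dense[of "max 1 (norm t)" R] assms(3,5) by auto
  then have \<rho>': "1 < \<rho>" "norm t \<le> \<rho>" "\<rho> < R" by auto
  note integral = jackson_sum_expansion[OF q_nz q_lt t_nz f_series \<rho>', of c]
  note series = Delta_sum_expansion[OF q_nz q_lt t_nz f_series \<rho>', of c]
  have total: "moment q c t 0 * (qpoch_inf c q * qpoch_inf (c * t) q)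
      = qpoch_inf q q * qpoch_inf t q * qpoch_inf (q / t) q"
    by (rule moment_0_eval[OF q_nz q_lt t_nz assms(7,9,10)])
  define Q where "Q = qpoch_inf q q * qpoch_inf t q * qpoch_inf (q / t) q"
  have "Q \<noteq> 0"
    using qpoch_q_inf_nonzero[OF q_nz q_lt] assms(7,8) by (simp add: Q_def)
  then have prefactor: "qpoch_inf c q * qpoch_inf (c * t) q / Q * moment q c t 0 = 1"
    using total by (simp add: Q_def mult.commute)
  have "(\<Sum>m. a m * moment q c t m) = (\<Sum>m. moment q c t 0 * (a m * al_salam_carlitz q c t m))"
    by (subst moment_eq_al_salam_carlitz[OF q_nz q_lt t_nz assms(9,10)])
      (simp only: mult.left_commute)
  also have "\<dots> = moment q c t 0 * (\<Sum>m. a m * al_salam_carlitz q c t m)"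
    by (rule suminf_mult[OF series(2)])
  finally have "qpoch_inf c q * qpoch_inf (c * t) q / Q * (\<Sum>m. a m * moment q c t m)
      = qpoch_inf c q * qpoch_inf (c * t) q / Q * moment q c t 0
        * (\<Sum>m. a m * al_salam_carlitz q c t m)"
    by (simp only: mult.assoc)
  then have "(\<Sum>m. a m * al_salam_carlitz q c t m) =
      qpoch_inf c q * qpoch_inf (c * t) q / Q * (\<Sum>m. a m * moment q c t m)"
    unfolding prefactor by (simp only: mult_1)
  moreover have "jackson_integrable q t 1 ?g"
    using integral unfolding jackson_integrable_def jackson_term_def by (rule sums_summable)
  moreover have "jackson_integral q t 1 ?g = (\<Sum>m. a m * moment q c t m)"
    using integral unfolding jackson_integral_def jackson_term_def by (rule sums_unique[symmetric])
  ultimately show ?thesis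
    using series(1) by (simp only: weight_def Q_def)
qed

end
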